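(* Let $\mathbb{A}$ be a unital $C^*$-algebra, let $(X,\mathbb{A},d)$ be a complete $C^*$-algebra valued metric space, let $\varphi: X\to\mathbb{A}_+$ be a function, let $F\in\mathcal{F}$, and let $T:X\to X$. Suppose that: (a) $\varphi$ is lower semi-continuous; (b) there is a real number $k\in(0,\tfrac12)$ such that for all $x,y\in X$ $$F(d(Tx,Ty),\varphi(Tx),\varphi(Ty))\preceq k\bigl[F(d(Tx,x),\varphi(Tx),\varphi(x))+F(d(Ty,y),\varphi(Ty),\varphi(y))\bigr].$$ Then: (i) $F_T\subseteq Z_\varphi$; (ii) $T$ is a $\varphi$-Picard operator.
   Context: $\mathbb{A}$ is a unital $C^*$-algebra with zero element $\theta$; $\mathbb{A}_+$ is the set of positive elements (self-adjoint with spectrum in $[0,\infty)$), and for self-adjoint $a,b$, $a\preceq b$ means $b-a\in\mathbb{A}_+$. A $C^*$-algebra valued metric space $(X,\mathbb{A},d)$ is a non-empty set $X$ with $d:X\times X\to\mathbb{A}$ such that for all $x,y,z$: $\theta\preceq d(x,y)$, with $d(x,y)=\theta$ iff $x=y$; $d(x,y)=d(y,x)$; $d(x,y)\preceq d(x,z)+d(z,y)$. Convergence $x_n\to x$ means $\|d(x_n,x)\|\to0$; $(x_n)$ is Cauchy if $\|d(x_n,x_m)\|\to 0$ as $n,m\to\infty$; the space is complete if every Cauchy sequence converges. $\mathcal{F}$ is the set of functions $F:\mathbb{A}_+^3\to\mathbb{A}_+$ such that (F1) $\max\{x,y\}\preceq F(x,y,z)$ for all $x,y,z\in\mathbb{A}_+$,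 meaning $x\preceq F(x,y,z)$ and $y\preceq F(x,y,z)$; (F2) $F(\theta,\theta,\theta)=\theta$; (F3) $F$ is (norm) continuous. $\varphi:X\to\mathbb{A}_+$ is lower semi-continuous if $x_n\to x$ in $X$ implies $\|\varphi(x)\|\le\liminf_n\|\varphi(x_n)\|$. $T^0$ is the identity of $X$ and $T^{n+1}=T\circ T^n$. $F_T=\{x\in X: Tx=x\}$ and $Z_\varphi=\{x\in X:\varphi(x)=\theta\}$. $T$ is a $\varphi$-Picard operator if $F_T\cap Z_\varphi=\{z\}$ for some $z\in X$ and $T^n x\to z$ as $n\to\infty$ for every $x\in X$. *)

theory Defs
  imports "HOL-Analysis.Analysis"
begin

text \<open>
  The real vector space structure inherited from \<open>banach\<close> is required to be the restriction of
  the complex one. The axiom \<open>norm 1 = 1\<close> of \<open>real_normed_algebra_1\<close> follows from the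
  C*-identity as soon as the algebra is nonzero.
\<close>

class cstar_algebra = real_normed_algebra_1 + banach +
  fixes scaleC :: "complex \<Rightarrow> 'a \<Rightarrow> 'a"  (infixr "*\<^sub>C" 75)
    and star :: "'a \<Rightarrow> 'a"
  assumes scaleC_add_right: "c *\<^sub>C (x + y) = c *\<^sub>C x + c *\<^sub>C y"
    and scaleC_add_left: "(b + c) *\<^sub>C x = b *\<^sub>C x + c *\<^sub>C x"
    and scaleC_scaleC: "b *\<^sub>C c *\<^sub>C x = (b * c) *\<^sub>C x"
    and scaleR_eq_scaleC: "r *\<^sub>R x = complex_of_real r *\<^sub>C x"
    and norm_scaleC: "norm (c *\<^sub>C x) = cmod c * norm x"
    and mult_scaleC_left: "(c *\<^sub>C x) * y = c *\<^sub>C (x * y)"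
    and mult_scaleC_right: "x * (c *\<^sub>C y) = c *\<^sub>C (x * y)"
    and star_add: "star (x + y) = star x + star y"
    and star_scaleC: "star (c *\<^sub>C x) = cnj c *\<^sub>C star x"
    and star_mult: "star (x * y) = star y * star x"
    and star_star: "star (star x) = x"
    and norm_star_mult: "norm (star x * x) = (norm x)\<^sup>2"

definition cstar_spectrum :: "'a::cstar_algebra \<Rightarrow> complex set" where
  "cstar_spectrum a =
     {c. \<not> (\<exists>b. (c *\<^sub>C 1 - a) * b = 1 \<and> b * (c *\<^sub>C 1 - a) = 1)}"

definition self_adjoint :: "'a::cstar_algebra \<Rightarrow> bool" where
  "self_adjoint a \<longleftrightarrow> star a = a"

definition cstar_pos :: "'a::cstar_algebra set" where
  "cstar_pos = {a. self_adjoint a \<and> cstar_spectrum a \<subseteq> complex_of_real ` {0..}}"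

definition cstar_le :: "'a::cstar_algebra \<Rightarrow> 'a \<Rightarrow> bool"  (infix "\<preceq>" 50) where
  "a \<preceq> b \<longleftrightarrow> self_adjoint a \<and> self_adjoint b \<and> b - a \<in> cstar_pos"

locale cstar_metric_space =
  fixes X :: "'x set" and d :: "'x \<Rightarrow> 'x \<Rightarrow> 'a::cstar_algebra"
  assumes nonempty: "X \<noteq> {}"
    and dist_pos: "\<lbrakk>x \<in> X; y \<in> X\<rbrakk> \<Longrightarrow> 0 \<preceq> d x y"
    and dist_eq_0_iff: "\<lbrakk>x \<in> X; y \<in> X\<rbrakk> \<Longrightarrow> d x y = 0 \<longleftrightarrow> x = y"
    and dist_commute: "\<lbrakk>x \<in> X; y \<in> X\<rbrakk> \<Longrightarrow> d x y = d y x"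
    and dist_triangle: "\<lbrakk>x \<in> X; y \<in> X; z \<in> X\<rbrakk> \<Longrightarrow> d x y \<preceq> d x z + d z y"

definition cstar_converges :: "('x \<Rightarrow> 'x \<Rightarrow> 'a::cstar_algebra) \<Rightarrow> (nat \<Rightarrow> 'x) \<Rightarrow> 'x \<Rightarrow> bool" where
  "cstar_converges d s x \<longleftrightarrow> (\<lambda>n. norm (d (s n) x)) \<longlonglongrightarrow> 0"

definition cstar_Cauchy :: "('x \<Rightarrow> 'x \<Rightarrow> 'a::cstar_algebra) \<Rightarrow> (nat \<Rightarrow> 'x) \<Rightarrow> bool" where
  "cstar_Cauchy d s \<longleftrightarrow> (\<forall>e>0. \<exists>N. \<forall>n\<ge>N. \<forall>m\<ge>N. norm (d (s n) (s m)) < e)"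

locale complete_cstar_metric_space = cstar_metric_space +
  assumes complete: "\<lbrakk>range s \<subseteq> X; cstar_Cauchy d s\<rbrakk> \<Longrightarrow> \<exists>x\<in>X. cstar_converges d s x"

text \<open>Functions in this class are only constrained on the positive cone.\<close>

definition F_class :: "('a::cstar_algebra \<Rightarrow> 'a \<Rightarrow> 'a \<Rightarrow> 'a) set" where
  "F_class = {F.
     (\<forall>x\<in>cstar_pos. \<forall>y\<in>cstar_pos. \<forall>z\<in>cstar_pos. F x y z \<in> cstar_pos) \<and>
     (\<forall>x\<in>cstar_pos. \<forall>y\<in>cstar_pos. \<forall>z\<in>cstar_pos. x \<preceq> F x y z \<and> y \<preceq> F x y z) \<and>
     F 0 0 0 = 0 \<and>
     continuous_on (cstar_pos \<times> cstar_pos \<times> cstar_pos) (\<lambda>(x, y, z). F x y z)}"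

text \<open>The lower limit is taken in \<open>ereal\<close>, since it may be infinite.\<close>

definition cstar_lsc ::
    "'x set \<Rightarrow> ('x \<Rightarrow> 'x \<Rightarrow> 'a::cstar_algebra) \<Rightarrow> ('x \<Rightarrow> 'a) \<Rightarrow> bool" where
  "cstar_lsc X d \<phi> \<longleftrightarrow>
     (\<forall>s. \<forall>x\<in>X. range s \<subseteq> X \<longrightarrow> cstar_converges d s x \<longrightarrow>
        ereal (norm (\<phi> x)) \<le> liminf (\<lambda>n. ereal (norm (\<phi> (s n)))))"

definition fixed_points :: "'x set \<Rightarrow> ('x \<Rightarrow> 'x) \<Rightarrow> 'x set" where
  "fixed_points X T = {x\<in>X. T x = x}"

definition zero_set :: "'x set \<Rightarrow> ('x \<Rightarrow> 'a::cstar_algebra) \<Rightarrow> 'x set" where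
  "zero_set X \<phi> = {x\<in>X. \<phi> x = 0}"

definition phi_Picard_operator ::
    "'x set \<Rightarrow> ('x \<Rightarrow> 'x \<Rightarrow> 'a::cstar_algebra) \<Rightarrow> ('x \<Rightarrow> 'a) \<Rightarrow> ('x \<Rightarrow> 'x) \<Rightarrow> bool" where
  "phi_Picard_operator X d \<phi> T \<longleftrightarrow>
     (\<exists>z\<in>X. fixed_points X T \<inter> zero_set X \<phi> = {z} \<and>
        (\<forall>x\<in>X. cstar_converges d (\<lambda>n. (T ^^ n) x) z))"

end

theory Submission
  imports Defs
begin

text \<open>
  The contraction condition is an inequality in the order of the algebra, but the proof uses only
  norms. Write \<open>G x y = F (d x y) (\<phi> x) (\<phi> y)\<close>. As the norm is monotone on the positive cone, the
  condition gives Kannan's inequality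
  \<open>norm (G (T x) (T y)) \<le> k * (norm (G (T x) x) + norm (G (T y) y))\<close>, while the domination of \<open>x\<close> and \<open>y\<close> by \<open>F x y z\<close> makes
  \<open>norm (G x y)\<close> an upper bound of both \<open>norm (d x y)\<close> and \<open>norm (\<phi> x)\<close>. Along an orbit \<open>s\<close> the
  numbers \<open>norm (G (s (n+1)) (s n))\<close> therefore decay like the powers of \<open>k / (1 - k) < 1\<close>. Hence the
  orbit is Cauchy, and \<open>\<phi>\<close> tends to zero along it, so that lower semi-continuity gives \<open>\<phi> z = 0\<close> at
  the limit \<open>z\<close>. Passing to the limit in Kannan's inequality for the pair \<open>(z, s n)\<close> yields
  \<open>norm (G (T z) z) \<le> k * norm (G (T z) z)\<close>, so \<open>T z = z\<close>. The order of the pair matters, since \<open>F\<close>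
  need not be symmetric: \<open>(s n, z)\<close> would bound \<open>G z (T z)\<close> by \<open>G (T z) z\<close>. At fixed points
  Kannan's inequality gives \<open>G x x = 0\<close>, which yields \<open>\<phi> x = 0\<close> and uniqueness.

  The facts about C*-algebras on which this rests all follow from one comparison,
  \<open>norm_le_of_order_bounds\<close>: if \<open>-q \<preceq> h \<preceq> p\<close> then \<open>norm h \<le> max (norm p) (norm q)\<close>. It contains
  monotonicity of the norm on positive elements (\<open>q = 0\<close>) and the continuity of the distance
  (\<open>p = q\<close>). Positivity being defined by the spectrum, the comparison needs that a self-adjoint
  element attains its norm on its spectrum (\<open>self_adjoint_norm_in_spectrum\<close>). This is proved
  without holomorphic functions: if the resolvent exists on the closed unit disc, averaging it over
  roots of unity forces the powers of the element to be small
  (\<open>power_small_of_resolvent_on_disc\<close>), whereas the C*-identity keeps the powers of a self-adjoint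
  element of norm one at norm one.
\<close>

section \<open>Inverses and spectrum in a C*-algebra\<close>

definition is_inverse :: "'a::monoid_mult \<Rightarrow> 'a \<Rightarrow> bool" where
  "is_inverse a b \<longleftrightarrow> a * b = 1 \<and> b * a = 1"

lemma scaleC_zero_left [simp]: "0 *\<^sub>C (x::'a::cstar_algebra) = 0"
  by (metis of_real_0 scaleR_eq_scaleC scaleR_zero_left)

lemma scaleC_one [simp]: "1 *\<^sub>C (x::'a::cstar_algebra) = x"
  by (metis of_real_1 scaleR_eq_scaleC scaleR_one)

lemma scaleC_minus_left: "(- c) *\<^sub>C (x::'a::cstar_algebra) = - (c *\<^sub>C x)"
  by (metis add.right_inverse add_eq_0_iff scaleC_add_left scaleC_zero_left)

lemma scaleC_diff_left: "(b - c) *\<^sub>C (x::'a::cstar_algebra) = b *\<^sub>C x - c *\<^sub>C x"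
  by (metis add_uminus_conv_diff scaleC_add_left scaleC_minus_left)

lemma scaleC_diff_right: "c *\<^sub>C (x - y) = c *\<^sub>C x - c *\<^sub>C (y::'a::cstar_algebra)"
  by (metis add_diff_cancel diff_add_cancel scaleC_add_right)

lemma star_zero [simp]: "star (0::'a::cstar_algebra) = 0"
  by (metis add_cancel_right_right star_add)

lemma star_minus: "star (- x) = - star (x::'a::cstar_algebra)"
  by (metis add.right_inverse add_eq_0_iff star_add star_zero)

lemma star_diff: "star (x - y) = star x - star (y::'a::cstar_algebra)"
  by (metis add_uminus_conv_diff star_add star_minus)

lemma star_one [simp]: "star (1::'a::cstar_algebra) = 1"
  by (metis mult.left_neutral mult.right_neutral star_mult star_star)

lemma star_scaleR: "star (r *\<^sub>R x) = r *\<^sub>R star (x::'a::cstar_algebra)"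
  by (simp add: scaleR_eq_scaleC star_scaleC)

lemma self_adjoint_scaleR_one: "self_adjoint (r *\<^sub>R (1::'a::cstar_algebra))"
  by (simp add: self_adjoint_def star_scaleR)

lemma self_adjoint_diff: "self_adjoint a \<Longrightarrow> self_adjoint b \<Longrightarrow> self_adjoint (a - b)"
  by (simp add: self_adjoint_def star_diff)

lemma not_in_cstar_spectrum: "c \<notin> cstar_spectrum a \<longleftrightarrow> (\<exists>b. is_inverse (c *\<^sub>C 1 - a) b)"
  by (simp add: cstar_spectrum_def is_inverse_def)

lemma cstar_spectrum_shift:
  "c \<in> cstar_spectrum (a::'a::cstar_algebra) \<longleftrightarrow> c + e \<in> cstar_spectrum (a + e *\<^sub>C 1)"
  by (simp add: cstar_spectrum_def scaleC_add_left)

lemma is_inverse_minus: "is_inverse a b \<Longrightarrow> is_inverse (- a) (- b)"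
  for a :: "'a::ring_1"
  by (simp add: is_inverse_def)

lemma cstar_spectrum_minus:
  "c \<in> cstar_spectrum (- a) \<longleftrightarrow> - c \<in> cstar_spectrum (a::'a::cstar_algebra)"
proof -
  have "(- c) *\<^sub>C 1 - a = - (c *\<^sub>C 1 - (- a))"
    by (simp add: scaleC_minus_left)
  then have "(\<exists>b. is_inverse (c *\<^sub>C 1 - (- a)) b) \<longleftrightarrow> (\<exists>b. is_inverse ((- c) *\<^sub>C 1 - a) b)"
    by (metis is_inverse_minus minus_minus)
  then show ?thesis
    using not_in_cstar_spectrum by blast
qed

lemma is_inverse_scaleC:
  assumes "c \<noteq> 0" and "is_inverse (a::'a::cstar_algebra) b"
  shows "is_inverse (c *\<^sub>C a) (inverse c *\<^sub>C b)"
  using assms by (simp add: is_inverse_def mult_scaleC_left mult_scaleC_right scaleC_scaleC)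

lemma neumann_inverse:
  fixes x :: "'a::{real_normed_algebra_1, banach}"
  assumes "norm x < 1"
  shows "is_inverse (1 - x) (\<Sum>n. x ^ n)"
proof -
  have sm: "summable (\<lambda>n. x ^ n)"
    using assms by (rule complete_algebra_summable_geometric)
  have lim: "(\<lambda>n. x ^ n) \<longlonglongrightarrow> 0"
    using assms by (rule LIMSEQ_power_zero)
  have tele: "(\<lambda>n. x ^ n - x ^ Suc n) sums (x ^ 0 - 0)"
    by (rule telescope_sums'[OF lim])
  have "(\<Sum>n. x ^ n) - x * (\<Sum>n. x ^ n) = (\<Sum>n. x ^ n - x ^ Suc n)"
    using suminf_diff[OF sm summable_mult[OF sm, of x]] suminf_mult[OF sm, of x] by simp
  moreover have "(\<Sum>n. x ^ n) - (\<Sum>n. x ^ n) * x = (\<Sum>n. x ^ n - x ^ Suc n)"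
    using suminf_diff[OF sm summable_mult2[OF sm, of x]] suminf_mult2[OF sm, of x]
    by (simp add: power_commutes)
  ultimately show ?thesis
    using sums_unique[OF tele] by (simp add: is_inverse_def algebra_simps)
qed

lemma cstar_spectrum_le_norm:
  fixes a :: "'a::cstar_algebra"
  assumes "c \<in> cstar_spectrum a"
  shows "cmod c \<le> norm a"
proof (rule ccontr)
  assume less: "\<not> cmod c \<le> norm a"
  then have c: "c \<noteq> 0" by auto
  have "norm (inverse c *\<^sub>C a) = norm a / cmod c"
    by (simp add: norm_scaleC norm_inverse divide_inverse mult.commute)
  then have "norm (inverse c *\<^sub>C a) < 1"
    using less c by (simp add: divide_less_eq)
  from is_inverse_scaleC[OF c neumann_inverse[OF this]] 
  have "\<exists>b. is_inverse (c *\<^sub>C 1 - a) b"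
    using c by (auto simp: scaleC_diff_right scaleC_scaleC)
  then show False using assms not_in_cstar_spectrum by blast
qed

text \<open>
  Arens' trick: \<open>c + i t\<close> lies in the spectrum of \<open>a + i t\<close>, whose squared norm is at most
  \<open>(norm a)\<^sup>2 + t\<^sup>2\<close> by the C*-identity. Expanding the square of the modulus leaves a term linear in
  \<open>t\<close> with coefficient \<open>2 * Im c\<close>, and it must stay bounded for all real \<open>t\<close>.
\<close>

lemma cstar_spectrum_self_adjoint_real:
  fixes a :: "'a::cstar_algebra"
  assumes "self_adjoint a" and "c \<in> cstar_spectrum a"
  shows "Im c = 0"
proof (rule ccontr)
  assume im: "Im c \<noteq> 0"
  have bound: "(cmod c)\<^sup>2 + 2 * Im c * t \<le> (norm a)\<^sup>2" for t :: real
  proof -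
    define e where "e = Complex 0 t"
    have "cnj e = - e" by (simp add: e_def complex_eq_iff)
    then have st: "star (a + e *\<^sub>C 1) = a - e *\<^sub>C 1"
      using assms(1) by (simp add: star_add star_scaleC self_adjoint_def scaleC_minus_left)
    have ee: "e * e = - complex_of_real (t\<^sup>2)"
      by (simp add: e_def complex_eq_iff power2_eq_square)
    have "(a - e *\<^sub>C 1) * (a + e *\<^sub>C 1) = a * a - (e * e) *\<^sub>C 1"
      by (simp add: algebra_simps mult_scaleC_left mult_scaleC_right scaleC_scaleC scaleC_diff_right)
    also have "\<dots> = a * a + t\<^sup>2 *\<^sub>R 1"
      by (simp add: ee scaleC_minus_left scaleR_eq_scaleC)
    finally have "(norm (a + e *\<^sub>C 1))\<^sup>2 = norm (a * a + t\<^sup>2 *\<^sub>R 1)"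
      using norm_star_mult[of "a + e *\<^sub>C 1"] st by simp
    also have "\<dots> \<le> (norm a)\<^sup>2 + t\<^sup>2"
      using norm_triangle_ineq[of "a * a" "t\<^sup>2 *\<^sub>R (1::'a)"] norm_mult_ineq[of a a]
      by (simp add: power2_eq_square)
    finally have 1: "(norm (a + e *\<^sub>C 1))\<^sup>2 \<le> (norm a)\<^sup>2 + t\<^sup>2" .
    have "cmod (c + e) \<le> norm (a + e *\<^sub>C 1)"
      using assms(2) cstar_spectrum_shift cstar_spectrum_le_norm by blast
    then have "(cmod (c + e))\<^sup>2 \<le> (norm a)\<^sup>2 + t\<^sup>2"
      using 1 by (meson norm_ge_zero order_trans power_mono)
    moreover have "(cmod (c + e))\<^sup>2 = (cmod c)\<^sup>2 + 2 * Im c * t + t\<^sup>2"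
      by (simp add: cmod_power2 e_def power2_sum)
    ultimately show ?thesis by simp
  qed
  \<comment> \<open>This value of \<open>t\<close> makes the linear term exceed the bound.\<close>
  have "(cmod c)\<^sup>2 + 2 * Im c * (((norm a)\<^sup>2 + 1) / (2 * Im c)) = (cmod c)\<^sup>2 + (norm a)\<^sup>2 + 1"
    using im by simp
  with bound[of "((norm a)\<^sup>2 + 1) / (2 * Im c)"] show False
    by (smt (verit) zero_le_power2)
qed

section \<open>The spectral radius of a self-adjoint element\<close>

text \<open>
  The partial fraction decomposition of \<open>1 / (1 - y\<^sup>2)\<close>. Iterated, it expresses the inverse of
  \<open>1 - y ^ (2 ^ n)\<close> as the mean of the inverses of \<open>1 - \<omega> y\<close> over the roots of unity \<open>\<omega>\<close> of order
  \<open>2 ^ n\<close>.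
\<close>

lemma inverse_one_minus_square:
  fixes y :: "'a::real_algebra_1"
  assumes "is_inverse (1 - y) b" and "is_inverse (1 + y) c"
  shows "is_inverse (1 - y * y) ((1/2) *\<^sub>R (b + c))"
proof -
  have f: "1 - y * y = (1 + y) * (1 - y)" "1 - y * y = (1 - y) * (1 + y)"
    by (simp_all add: algebra_simps)
  have "(1 - y * y) * b = (1 + y) * ((1 - y) * b)" "(1 - y * y) * c = (1 - y) * ((1 + y) * c)"
    unfolding mult.assoc[symmetric] f(1)[symmetric] f(2)[symmetric] by simp_all
  moreover have "b * (1 - y * y) = (b * (1 - y)) * (1 + y)" "c * (1 - y * y) = (c * (1 + y)) * (1 - y)"
    unfolding mult.assoc f(1)[symmetric] f(2)[symmetric] by simp_all
  moreover have "(1/2) *\<^sub>R (2::'a) = 1" by (metis one_add_one scaleR_half_double)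
  ultimately show ?thesis
    using assms unfolding is_inverse_def
    by (simp del: distrib_left distrib_right add: distrib_left[of "1 - y * y"] distrib_right[of b c])
qed

lemma resolvent_identity:
  fixes h :: "'a::cstar_algebra"
  assumes "is_inverse (1 - v *\<^sub>C h) b" and "is_inverse (1 - w *\<^sub>C h) c"
  shows "b - c = (v - w) *\<^sub>C (b * h * c)"
proof -
  have "b * ((1 - w *\<^sub>C h) - (1 - v *\<^sub>C h)) * c = b - c"
  proof -
    have "b * ((1 - w *\<^sub>C h) - (1 - v *\<^sub>C h)) * c
        = b * ((1 - w *\<^sub>C h) * c) - (b * (1 - v *\<^sub>C h)) * c"
      by (simp only: right_diff_distrib left_diff_distrib mult.assoc)
    then show ?thesis using assms by (simp add: is_inverse_def)
  qed
  moreover have "(1 - w *\<^sub>C h) - (1 - v *\<^sub>C h) = (v - w) *\<^sub>C h"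
    by (simp add: scaleC_diff_left)
  ultimately show ?thesis
    by (simp add: mult_scaleC_left mult_scaleC_right)
qed

text \<open>
  If \<open>v\<close> is so near to \<open>w\<close> that \<open>cmod (v - w) * norm h * norm (Q w) \<le> 1/2\<close>, the resolvent identity gives
  \<open>norm (Q v) \<le> 2 * norm (Q w)\<close>. Inserting this bound into the identity again makes \<open>Q\<close> continuous.
\<close>

lemma resolvent_bounded_on_compact:
  fixes h :: "'a::cstar_algebra"
  assumes "compact K" and "\<And>w. w \<in> K \<Longrightarrow> is_inverse (1 - w *\<^sub>C h) (Q w)"
  shows "\<exists>M. \<forall>w\<in>K. norm (Q w) \<le> M"
proof -
  have ineq: "norm (Q v - Q w) \<le> cmod (v - w) * (norm (Q v) * norm h * norm (Q w))"
    if "v \<in> K" "w \<in> K" for v w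
  proof -
    have "norm (Q v * h * Q w) \<le> norm (Q v) * norm h * norm (Q w)"
      by (meson mult_right_mono norm_ge_zero norm_mult_ineq order_trans)
    then show ?thesis
      using that assms(2) resolvent_identity[of v h "Q v" w "Q w"]
      by (simp add: norm_scaleC mult_left_mono)
  qed
  have cont: "continuous_on K Q"
    unfolding continuous_on_def
  proof
    fix w assume w: "w \<in> K"
    define B where "B = norm h * norm (Q w)"
    have B: "B \<ge> 0" by (simp add: B_def)
    have near: "norm (Q v - Q w) \<le> cmod (v - w) * (2 * norm (Q w) * B)"
      if v: "v \<in> K" "cmod (v - w) < 1 / (2 * (B + 1))" for v
    proof -
      have le: "norm (Q v - Q w) \<le> cmod (v - w) * B * norm (Q v)"
        using ineq[OF v(1) w] by (simp add: B_def algebra_simps)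
      have "cmod (v - w) * B \<le> 1 / (2 * (B + 1)) * B"
        using v B by (intro mult_right_mono) auto
      also have "\<dots> \<le> 1/2" using B by (simp add: field_simps)
      finally have "cmod (v - w) * B * norm (Q v) \<le> 1/2 * norm (Q v)"
        by (intro mult_right_mono) auto
      then have "norm (Q v) \<le> 2 * norm (Q w)"
        using le norm_triangle_ineq2[of "Q v" "Q w"] by linarith
      then have "cmod (v - w) * B * norm (Q v) \<le> cmod (v - w) * B * (2 * norm (Q w))"
        using B by (intro mult_left_mono) auto
      then show ?thesis using le by (simp add: algebra_simps)
    qed
    have ev: "\<forall>\<^sub>F v in at w within K. cmod (v - w) < 1 / (2 * (B + 1))"
      using B by (auto simp: eventually_at dist_norm intro!: exI[of _ "1 / (2 * (B + 1))"])
    have "\<forall>\<^sub>F v in at w within K. v \<in> K" by (simp add: eventually_at_filter)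
    then have "\<forall>\<^sub>F v in at w within K. norm (Q v - Q w) \<le> cmod (v - w) * (2 * norm (Q w) * B)"
      using ev by eventually_elim (rule near)
    moreover have "((\<lambda>v. cmod (v - w) * (2 * norm (Q w) * B)) \<longlongrightarrow> 0) (at w within K)"
      by (auto intro!: tendsto_eq_intros)
    ultimately have "((\<lambda>v. Q v - Q w) \<longlongrightarrow> 0) (at w within K)"
      by (rule Lim_null_comparison)
    then show "(Q \<longlongrightarrow> Q w) (at w within K)" by (simp add: LIM_zero_iff)
  qed
  then have "bounded (Q ` K)"
    using assms(1) compact_continuous_image compact_imp_bounded by blast
  then show ?thesis by (auto simp: bounded_iff)
qed

text \<open>
  Comparing the resolvent on the unit circle with that on the circle of radius \<open>r\<close>: means of pairs
  that differ by at most \<open>\<epsilon>\<close> again differ by at most \<open>\<epsilon>\<close>, so the estimate passes unchanged from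
  \<open>h\<close> to \<open>h\<^sup>2\<close>, and its bound does not depend on \<open>n\<close>. The induction needs all \<open>w\<close> on the circle
  because it descends from \<open>w\<close> to both of its square roots.
\<close>

lemma resolvent_pair_doubling:
  fixes h :: "'a::cstar_algebra" and r \<epsilon> :: real
  assumes "\<And>w. cmod w = 1 \<Longrightarrow> \<exists>b c. is_inverse (1 - w *\<^sub>C h) b
             \<and> is_inverse (1 - (of_real r * w) *\<^sub>C h) c \<and> norm (b - c) \<le> \<epsilon>"
    and "cmod w = 1"
  shows "\<exists>b c. is_inverse (1 - w *\<^sub>C h ^ (2 ^ n)) b
             \<and> is_inverse (1 - (of_real (r ^ (2 ^ n)) * w) *\<^sub>C h ^ (2 ^ n)) c \<and> norm (b - c) \<le> \<epsilon>"
  using assms(2)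
proof (induction n arbitrary: w)
  case 0
  then show ?case using assms(1) by simp
next
  case (Suc n)
  define x where "x = h ^ (2 ^ n)"
  define \<rho> where "\<rho> = complex_of_real (r ^ (2 ^ n))"
  have x2: "h ^ (2 ^ Suc n) = x * x" and \<rho>2: "complex_of_real (r ^ (2 ^ Suc n)) = \<rho> * \<rho>"
    by (simp_all add: x_def \<rho>_def mult_2 power_add)
  define v where "v = csqrt w"
  have vv: "v * v = w" and v: "cmod v = 1" "cmod (- v) = 1"
    using Suc.prems power2_csqrt[of w] by (simp_all add: v_def power2_eq_square norm_csqrt)
  obtain b c where bc: "is_inverse (1 - v *\<^sub>C x) b" "is_inverse (1 - (\<rho> * v) *\<^sub>C x) c" "norm (b - c) \<le> \<epsilon>"
    using Suc.IH[OF v(1)] unfolding x_def \<rho>_def by blast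
  obtain b' c' where bc': "is_inverse (1 - (- v) *\<^sub>C x) b'" "is_inverse (1 - (\<rho> * (- v)) *\<^sub>C x) c'"
      "norm (b' - c') \<le> \<epsilon>"
    using Suc.IH[OF v(2)] unfolding x_def \<rho>_def by blast
  have "is_inverse (1 - w *\<^sub>C (x * x)) ((1/2) *\<^sub>R (b + b'))"
    using inverse_one_minus_square[of "v *\<^sub>C x" b b'] bc(1) bc'(1)
    by (simp add: scaleC_minus_left mult_scaleC_left mult_scaleC_right scaleC_scaleC vv)
  moreover have "is_inverse (1 - (\<rho> * \<rho> * w) *\<^sub>C (x * x)) ((1/2) *\<^sub>R (c + c'))"
  proof -
    have eq: "\<rho> * \<rho> * w = (\<rho> * v) * (\<rho> * v)"
      unfolding vv[symmetric] by (simp only: ac_simps)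
    show ?thesis
      unfolding eq using inverse_one_minus_square[of "(\<rho> * v) *\<^sub>C x" c c'] bc(2) bc'(2)
      by (simp add: scaleC_minus_left mult_scaleC_left mult_scaleC_right scaleC_scaleC)
  qed
  moreover have "norm ((1/2) *\<^sub>R (b + b') - (1/2) *\<^sub>R (c + c')) \<le> \<epsilon>"
  proof -
    have "(1/2) *\<^sub>R (b + b') - (1/2) *\<^sub>R (c + c') = (1/2) *\<^sub>R ((b - c) + (b' - c'))"
      by (simp add: algebra_simps)
    then show ?thesis
      using norm_triangle_ineq[of "b - c" "b' - c'"] bc(3) bc'(3) by simp
  qed
  ultimately show ?case unfolding x2 \<rho>2 by blast
qed

text \<open>
  Rickart's argument. The resolvent is Lipschitz on the closed disc, so for \<open>r\<close> near \<open>1\<close> its values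
  at \<open>w\<close> and \<open>r w\<close> are close. For large \<open>N = 2 ^ n\<close> the inverse of \<open>1 - r ^ N h ^ N\<close> is close to
  \<open>1\<close> because \<open>r ^ N\<close> is small. By the uniform estimate above, so is the inverse of \<open>1 - h ^ N\<close>,
  which forces \<open>h ^ N\<close> to be small.
\<close>

lemma power_small_of_resolvent_on_disc:
  fixes h :: "'a::cstar_algebra"
  assumes "norm h \<le> 1" and "\<And>w. cmod w \<le> 1 \<Longrightarrow> \<exists>b. is_inverse (1 - w *\<^sub>C h) b"
  shows "\<exists>n. norm (h ^ (2 ^ n)) < 1"
proof -
  obtain Q where Q: "is_inverse (1 - w *\<^sub>C h) (Q w)" if "cmod w \<le> 1" for w
    using assms(2) by metis
  obtain M where M: "\<forall>w\<in>cball 0 1. norm (Q w) \<le> M"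
    using resolvent_bounded_on_compact[of "cball 0 1" h Q] Q by (auto simp: dist_norm)
  have M0: "0 \<le> M" using M[rule_format, of 0] norm_ge_zero[of "Q 0"] by (simp del: norm_ge_zero)
  \<comment> \<open>\<open>M * M\<close> is a Lipschitz constant of the resolvent, so moving by \<open>\<delta>\<close> changes it by at most \<open>1/8\<close>.\<close>
  define \<delta> where "\<delta> = 1 / (8 * (M * M + 1))"
  define r where "r = 1 - \<delta>"
  have \<delta>: "0 < \<delta>" "\<delta> \<le> 1/8" "\<delta> * (M * M) \<le> 1/8"
    using M0 by (auto simp: \<delta>_def field_simps add_pos_nonneg intro!: divide_pos_pos add_nonneg_pos)
  then have r: "0 < r" "r < 1" by (auto simp: r_def)
  have pair: "\<exists>b c. is_inverse (1 - w *\<^sub>C h) b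
             \<and> is_inverse (1 - (of_real r * w) *\<^sub>C h) c \<and> norm (b - c) \<le> 1/8" if w: "cmod w = 1" for w
  proof (intro exI conjI)
    have rw: "cmod (of_real r * w) \<le> 1" using r w by (simp add: norm_mult)
    show 1: "is_inverse (1 - w *\<^sub>C h) (Q w)" using Q w by simp
    show 2: "is_inverse (1 - (of_real r * w) *\<^sub>C h) (Q (of_real r * w))" using Q rw by simp
    have "w - of_real r * w = of_real \<delta> * w" by (simp add: r_def algebra_simps)
    then have "norm (Q w - Q (of_real r * w)) = \<delta> * norm (Q w * h * Q (of_real r * w))"
      using resolvent_identity[OF 1 2] w \<delta> by (simp add: norm_scaleC norm_mult)
    also have "norm (Q w * h * Q (of_real r * w)) \<le> norm (Q w) * norm h * norm (Q (of_real r * w))"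
      by (meson mult_right_mono norm_ge_zero norm_mult_ineq order_trans)
    also have "\<dots> \<le> M * 1 * M"
      using M w rw assms(1) M0 by (intro mult_mono) auto
    finally show "norm (Q w - Q (of_real r * w)) \<le> 1/8" using \<delta> by simp
  qed
  obtain n where n: "r ^ n < 1/8"
    using real_arch_pow_inv[of "1/8" r] r by auto
  define N where "N = (2::nat) ^ n"
  have "r ^ N \<le> r ^ n"
    unfolding N_def using r by (intro power_decreasing) auto
  then have rN: "r ^ N < 1/8" "0 < r ^ N" using n r by (linarith, simp)
  define x where "x = h ^ N"
  have x: "norm x \<le> 1"
    unfolding x_def using assms(1) norm_power_ineq[of h N] by (meson norm_ge_zero order_trans power_le_one)
  obtain b c where b: "is_inverse (1 - x) b" and c: "is_inverse (1 - r ^ N *\<^sub>R x) c"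
      and bc: "norm (b - c) \<le> 1/8"
    using resolvent_pair_doubling[of h r "1/8" 1 n, OF pair] unfolding x_def N_def
    by (auto simp: scaleR_eq_scaleC)
  \<comment> \<open>From \<open>c (1 - y) = 1\<close> with \<open>norm y \<le> 1/8\<close> one gets \<open>norm (c - 1) \<le> 1/7\<close>, and \<open>1/7 + 1/8 < 1/2\<close>.\<close>
  define y where "y = r ^ N *\<^sub>R x"
  have y: "norm y \<le> 1/8" using rN x by (simp add: y_def) (smt (verit) mult_left_le)
  have "c - 1 = y + y * (c - 1)"
    using c by (simp add: is_inverse_def y_def algebra_simps)
  then have "norm (c - 1) \<le> norm y + norm y * norm (c - 1)"
    by (metis norm_mult_ineq norm_triangle_le add_left_mono)
  also have "\<dots> \<le> 1/8 + 1/8 * norm (c - 1)"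
    using y by (intro add_mono mult_right_mono) auto
  finally have "norm (b - 1) < 1/2"
    using norm_triangle_ineq[of "b - c" "c - 1"] bc by simp
  moreover have "x = (1 - x) * (b - 1)"
    using b by (simp add: is_inverse_def algebra_simps)
  then have "norm x \<le> norm (1 - x) * norm (b - 1)"
    by (metis norm_mult_ineq)
  moreover have "norm (1 - x) \<le> 2" using x norm_triangle_ineq4[of 1 x] by simp
  then have "norm (1 - x) * norm (b - 1) \<le> 2 * norm (b - 1)"
    by (rule mult_right_mono) auto
  ultimately have "norm x < 1" by linarith
  then show ?thesis unfolding x_def N_def by blast
qed

lemma norm_self_adjoint_power:
  fixes h :: "'a::cstar_algebra"
  assumes "self_adjoint h"
  shows "norm (h ^ (2 ^ n)) = norm h ^ (2 ^ n)"
proof -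
  have sa: "self_adjoint (h ^ m)" for m
    using assms by (induction m) (auto simp: self_adjoint_def star_mult power_commutes)
  show ?thesis
  proof (induction n)
    case (Suc n)
    have "h ^ (2 ^ Suc n) = star (h ^ (2 ^ n)) * h ^ (2 ^ n)"
      using sa by (simp add: self_adjoint_def mult_2 power_add)
    then show ?case
      using Suc by (simp add: norm_star_mult power2_eq_square mult_2 power_add)
  qed simp
qed

text \<open>
  For \<open>u\<close> of norm one, points \<open>w\<close> of the open disc have invertible \<open>1 - w u\<close> by the Neumann series,
  and those of the unit circle correspond through \<open>c = norm h / w\<close> to the points \<open>c\<close> of modulus
  \<open>norm h\<close>. If none of these were in the spectrum, some power \<open>u ^ (2 ^ n)\<close> would have norm below one,
  against the C*-identity.
\<close>

lemma self_adjoint_norm_in_spectrum: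
  fixes h :: "'a::cstar_algebra"
  assumes "self_adjoint h"
  obtains t :: real where "complex_of_real t \<in> cstar_spectrum h" and "\<bar>t\<bar> = norm h"
proof -
  have "\<exists>c \<in> cstar_spectrum h. cmod c = norm h"
  proof (cases "h = 0")
    case True
    then have "0 \<in> cstar_spectrum h" by (simp add: cstar_spectrum_def)
    then show ?thesis using True by force
  next
    case False
    define N where "N = norm h"
    have N: "N > 0" using False by (simp add: N_def)
    define u where "u = inverse N *\<^sub>R h"
    have u: "norm u = 1" "self_adjoint u"
      using N assms by (simp_all add: u_def N_def self_adjoint_def star_scaleR)
    show ?thesis
    proof (rule ccontr)
      assume none: "\<not> ?thesis"
      have "\<exists>b. is_inverse (1 - w *\<^sub>C u) b" if w: "cmod w \<le> 1" for w
      proof (cases "cmod w < 1")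
        case True
        then show ?thesis
          using neumann_inverse[of "w *\<^sub>C u"] u by (auto simp: norm_scaleC)
      next
        case False
        then have w1: "cmod w = 1" using w by simp
        then have w0: "w \<noteq> 0" by auto
        define c where "c = of_real N * inverse w"
        have "cmod c = norm h"
          using w1 N by (simp add: c_def norm_mult norm_inverse N_def)
        then obtain b where b: "is_inverse (c *\<^sub>C 1 - h) b"
          using none not_in_cstar_spectrum by blast
        have c0: "inverse c \<noteq> 0" and ic: "inverse c = w * of_real (inverse N)"
          using w0 N by (simp_all add: c_def)
        have "inverse c *\<^sub>C (c *\<^sub>C 1 - h) = 1 - w *\<^sub>C u"
          using c0 by (simp add: scaleC_diff_right scaleC_scaleC u_def scaleR_eq_scaleC ic[symmetric] del: inverse_mult_distrib of_real_inverse)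
        then show ?thesis using is_inverse_scaleC[OF c0 b] by metis
      qed
      then obtain n where "norm (u ^ (2 ^ n)) < 1"
        using power_small_of_resolvent_on_disc[of u] u by auto
      then show False using norm_self_adjoint_power[OF u(2)] u(1) by simp
    qed
  qed
  then obtain c where c: "c \<in> cstar_spectrum h" "cmod c = norm h" by blast
  have "c = complex_of_real (Re c)"
    using cstar_spectrum_self_adjoint_real[OF assms c(1)] by (simp add: complex_eq_iff)
  then show thesis using that[of "Re c"] c by (metis norm_of_real)
qed

section \<open>Order and norm\<close>

lemma cstar_pos_self_adjoint: "a \<in> cstar_pos \<Longrightarrow> self_adjoint a"
  by (simp add: cstar_pos_def)

text \<open>
  The spectrum of a positive \<open>a\<close> lies in \<open>[0, norm a]\<close>, so that of \<open>norm a - a\<close> lies in the same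
  interval. Being a bound on a norm, the conclusion is stable under addition; this replaces the
  theorem that sums of positive elements are positive.
\<close>

lemma cstar_pos_norm_shift:
  assumes "a \<in> cstar_pos"
  shows "norm (norm a *\<^sub>R 1 - a) \<le> norm a"
proof -
  obtain t where t: "complex_of_real t \<in> cstar_spectrum (norm a *\<^sub>R 1 - a)"
      "\<bar>t\<bar> = norm (norm a *\<^sub>R 1 - a)"
    using self_adjoint_norm_in_spectrum self_adjoint_diff[OF self_adjoint_scaleR_one cstar_pos_self_adjoint[OF assms]]
    by blast
  have "complex_of_real t - of_real (norm a) \<in> cstar_spectrum (- a)"
    using t(1) cstar_spectrum_shift[of "complex_of_real t - of_real (norm a)" "- a" "of_real (norm a)"]
    by (simp add: scaleR_eq_scaleC)
  then have s: "complex_of_real (norm a - t) \<in> cstar_spectrum a"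
    by (simp add: cstar_spectrum_minus)
  then have "norm a - t \<ge> 0" using assms
    by (auto simp: cstar_pos_def simp del: of_real_diff)
  moreover have "\<bar>norm a - t\<bar> \<le> norm a"
    using cstar_spectrum_le_norm[OF s] by (metis norm_of_real)
  ultimately show ?thesis using t(2) by linarith
qed

text \<open>
  With \<open>r = p - h\<close>, the element \<open>h + norm r\<close> equals \<open>p + (norm r - r)\<close> and so has norm at most
  \<open>norm p + norm r\<close>; shifting its spectrum back by \<open>norm r\<close> bounds that of \<open>h\<close> from above.
\<close>

lemma spectrum_le_norm_of_upper_bound:
  fixes h p :: "'a::cstar_algebra"
  assumes "p - h \<in> cstar_pos" and "complex_of_real t \<in> cstar_spectrum h"
  shows "t \<le> norm p"
proof -
  define r where "r = p - h"
  have "complex_of_real (t + norm r) \<in> cstar_spectrum (h + norm r *\<^sub>R 1)"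
    using assms(2) cstar_spectrum_shift[of "of_real t" h "of_real (norm r)"]
    by (simp add: scaleR_eq_scaleC)
  then have "\<bar>t + norm r\<bar> \<le> norm (h + norm r *\<^sub>R 1)"
    using cstar_spectrum_le_norm by (metis norm_of_real)
  also have "h + norm r *\<^sub>R 1 = p + (norm r *\<^sub>R 1 - r)" by (simp add: r_def)
  also have "norm \<dots> \<le> norm p + norm r"
    using cstar_pos_norm_shift[OF assms(1)] norm_triangle_ineq[of p "norm r *\<^sub>R 1 - r"]
    unfolding r_def by linarith
  finally show ?thesis by linarith
qed

lemma norm_le_of_order_bounds:
  fixes h p q :: "'a::cstar_algebra"
  assumes "self_adjoint h" and "p - h \<in> cstar_pos" and "h + q \<in> cstar_pos"
  shows "norm h \<le> max (norm p) (norm q)"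
proof -
  obtain t where t: "complex_of_real t \<in> cstar_spectrum h" "\<bar>t\<bar> = norm h"
    using self_adjoint_norm_in_spectrum[OF assms(1)] .
  have "t \<le> norm p" using spectrum_le_norm_of_upper_bound assms(2) t(1) by blast
  moreover have "- t \<le> norm q"
    using spectrum_le_norm_of_upper_bound[of q "- h" "- t"] assms(3) t(1)
    by (simp add: cstar_spectrum_minus add.commute)
  ultimately show ?thesis using t(2) by linarith
qed

lemma zero_le_iff_cstar_pos: "0 \<preceq> a \<longleftrightarrow> a \<in> cstar_pos"
  by (auto simp: cstar_le_def cstar_pos_def self_adjoint_def)

lemma norm_mono_cstar_pos:
  assumes "a \<in> cstar_pos" and "a \<preceq> b"
  shows "norm a \<le> norm b"
  using norm_le_of_order_bounds[of a b 0] assms by (auto simp: cstar_le_def)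

section \<open>C*-algebra valued metric spaces\<close>

context cstar_metric_space
begin

lemma dist_in_pos: "x \<in> X \<Longrightarrow> y \<in> X \<Longrightarrow> d x y \<in> cstar_pos"
  using dist_pos zero_le_iff_cstar_pos by blast

lemma norm_dist_triangle:
  assumes "x \<in> X" "y \<in> X" "z \<in> X"
  shows "norm (d x y) \<le> norm (d x z) + norm (d z y)"
  using norm_mono_cstar_pos[OF dist_in_pos dist_triangle] assms norm_triangle_ineq order_trans by blast

text \<open>
  The two triangle inequalities through \<open>x\<close> and through \<open>y\<close> say that \<open>d z x - d z y\<close> lies between
  \<open>- d x y\<close> and \<open>d x y\<close>.
\<close>

lemma norm_dist_diff:
  assumes "x \<in> X" "y \<in> X" "z \<in> X"
  shows "norm (d z x - d z y) \<le> norm (d x y)"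
proof -
  have "d x y - (d z x - d z y) \<in> cstar_pos"
    using dist_triangle[of z x y] dist_commute[of x y] assms by (simp add: cstar_le_def algebra_simps)
  moreover have "(d z x - d z y) + d x y \<in> cstar_pos"
    using dist_triangle[of z y x] assms by (simp add: cstar_le_def algebra_simps)
  moreover have "self_adjoint (d z x - d z y)"
    using dist_in_pos assms by (blast intro: self_adjoint_diff cstar_pos_self_adjoint)
  ultimately show ?thesis using norm_le_of_order_bounds by fastforce
qed

lemma geometric_cstar_Cauchy:
  assumes "range s \<subseteq> X" and "0 \<le> q" "q < 1"
    and step: "\<And>n. norm (d (s n) (s (Suc n))) \<le> C * q ^ n"
  shows "cstar_Cauchy d s"
proof -
  have sX: "s n \<in> X" for n using assms(1) by auto
  have C: "C \<ge> 0" using step[of 0] norm_ge_zero[of "d (s 0) (s 1)"] by (simp del: norm_ge_zero)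
  have bound: "norm (d (s n) (s (n + j))) \<le> C / (1 - q) * q ^ n" for n j
  proof -
    have "norm (d (s n) (s (n + j))) \<le> C / (1 - q) * (q ^ n - q ^ (n + j))"
    proof (induction j)
      case 0
      then show ?case using sX dist_eq_0_iff[of "s n" "s n"] by simp
    next
      case (Suc j)
      have "norm (d (s n) (s (n + Suc j))) \<le> norm (d (s n) (s (n + j))) + norm (d (s (n + j)) (s (Suc (n + j))))"
        using norm_dist_triangle sX by simp
      also have "\<dots> \<le> C / (1 - q) * (q ^ n - q ^ (n + j)) + C * q ^ (n + j)"
        using Suc.IH step[of "n + j"] by (rule add_mono)
      also have "\<dots> = C / (1 - q) * (q ^ n - q ^ (n + Suc j))"
        using assms(3) by (simp add: field_simps)
      finally show ?case .
    qed
    also have "\<dots> \<le> C / (1 - q) * q ^ n"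
      using C assms(2,3) by (intro mult_left_mono) auto
    finally show ?thesis .
  qed
  have lim: "(\<lambda>n. C / (1 - q) * q ^ n) \<longlonglongrightarrow> 0"
    using LIMSEQ_power_zero[of q] assms(2,3) by (intro tendsto_mult_right_zero) simp
  show ?thesis
    unfolding cstar_Cauchy_def
  proof (intro allI impI)
    fix e :: real assume "e > 0"
    then obtain N where N: "\<And>n. n \<ge> N \<Longrightarrow> C / (1 - q) * q ^ n < e"
      using order_tendstoD(2)[OF lim] by (auto simp: eventually_sequentially)
    have *: "norm (d (s n) (s m)) < e" if "n \<ge> N" "n \<le> m" for n m
      using bound[of n "m - n"] N[of n] that by simp
    show "\<exists>N. \<forall>n\<ge>N. \<forall>m\<ge>N. norm (d (s n) (s m)) < e"
      using * dist_commute[OF sX sX] by (metis nle_le)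
  qed
qed

end


section \<open>Kannan contractions and \<open>\<phi>\<close>-Picard operators\<close>

lemma F_class_norm_le:
  assumes "F \<in> F_class" and "x \<in> cstar_pos" "y \<in> cstar_pos" "z \<in> cstar_pos"
  shows "norm x \<le> norm (F x y z)" and "norm y \<le> norm (F x y z)"
  using assms norm_mono_cstar_pos unfolding F_class_def by blast+

lemma F_class_tendsto:
  assumes "F \<in> F_class"
    and "x \<longlonglongrightarrow> x0" "y \<longlonglongrightarrow> y0" "z \<longlonglongrightarrow> z0"
    and "\<And>n. x n \<in> cstar_pos" "\<And>n. y n \<in> cstar_pos" "\<And>n. z n \<in> cstar_pos"
    and "x0 \<in> cstar_pos" "y0 \<in> cstar_pos" "z0 \<in> cstar_pos"
  shows "(\<lambda>n. F (x n) (y n) (z n)) \<longlonglongrightarrow> F x0 y0 z0"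
proof -
  have "continuous_on (cstar_pos \<times> cstar_pos \<times> cstar_pos) (\<lambda>(x, y, z). F x y z)"
    using assms(1) by (simp add: F_class_def)
  moreover have "(\<lambda>n. (x n, y n, z n)) \<longlonglongrightarrow> (x0, y0, z0)"
    using assms(2-4) by (intro tendsto_Pair)
  ultimately show ?thesis
    using continuous_on_tendsto_compose[where f = "\<lambda>(x, y, z). F x y z"] assms(5-) by fastforce
qed

theorem theorem3p15:
  fixes X :: "'x set"
    and d :: "'x \<Rightarrow> 'x \<Rightarrow> 'a::cstar_algebra"
    and \<phi> :: "'x \<Rightarrow> 'a"
    and F :: "'a \<Rightarrow> 'a \<Rightarrow> 'a \<Rightarrow> 'a"
    and T :: "'x \<Rightarrow> 'x"
  assumes "complete_cstar_metric_space X d"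
    and "\<phi> \<in> X \<rightarrow> cstar_pos"
    and "F \<in> F_class"
    and "T \<in> X \<rightarrow> X"
    and "cstar_lsc X d \<phi>"
    and "\<exists>k::real. 0 < k \<and> k < 1/2 \<and>
           (\<forall>x\<in>X. \<forall>y\<in>X.
              F (d (T x) (T y)) (\<phi> (T x)) (\<phi> (T y)) \<preceq>
                k *\<^sub>R (F (d (T x) x) (\<phi> (T x)) (\<phi> x) + F (d (T y) y) (\<phi> (T y)) (\<phi> y)))"
  shows "fixed_points X T \<subseteq> zero_set X \<phi> \<and> phi_Picard_operator X d \<phi> T"
proof -
  interpret complete_cstar_metric_space X d by (rule assms(1))
  have TX: "T x \<in> X" and \<phi>_pos: "\<phi> x \<in> cstar_pos" if "x \<in> X" for x
    using that assms(2,4) by auto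
  have self: "d x x = 0" if "x \<in> X" for x
    using dist_eq_0_iff that by blast
  define G where "G x y = F (d x y) (\<phi> x) (\<phi> y)" for x y
  have G_pos: "G x y \<in> cstar_pos" if "x \<in> X" "y \<in> X" for x y
    using assms(3) that dist_in_pos \<phi>_pos by (simp add: G_def F_class_def)
  have d_le_G: "norm (d x y) \<le> norm (G x y)" and \<phi>_le_G: "norm (\<phi> x) \<le> norm (G x y)"
    if "x \<in> X" "y \<in> X" for x y
    unfolding G_def using F_class_norm_le[OF assms(3)] that dist_in_pos \<phi>_pos by simp_all
  obtain k :: real where k: "0 < k" "k < 1/2"
    and contr: "\<And>x y. x \<in> X \<Longrightarrow> y \<in> X \<Longrightarrow> G (T x) (T y) \<preceq> k *\<^sub>R (G (T x) x + G (T y) y)"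
    using assms(6) unfolding G_def by blast
  have kannan: "norm (G (T x) (T y)) \<le> k * (norm (G (T x) x) + norm (G (T y) y))"
    if "x \<in> X" "y \<in> X" for x y
  proof -
    have "norm (G (T x) (T y)) \<le> norm (k *\<^sub>R (G (T x) x + G (T y) y))"
      using norm_mono_cstar_pos[OF G_pos contr] that TX by blast
    also have "\<dots> = k * norm (G (T x) x + G (T y) y)" using k by simp
    also have "\<dots> \<le> k * (norm (G (T x) x) + norm (G (T y) y))"
      using k by (intro mult_left_mono norm_triangle_ineq) auto
    finally show ?thesis .
  qed
  \<comment> \<open>Used with \<open>c = 2 * k\<close> at fixed points and with \<open>c = k\<close> at the limit of an orbit.\<close>
  have contract_zero: "a = 0" if "norm a \<le> c * norm a" "c < 1" for a :: 'a and c
  proof (rule ccontr)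
    assume "a \<noteq> 0"
    then have "c * norm a < 1 * norm a" using that(2) by (intro mult_strict_right_mono) auto
    then show False using that(1) by simp
  qed
  have G_fixed: "G x x = 0" if "x \<in> X" "T x = x" for x
    using contract_zero[of "G x x" "2 * k"] kannan[of x x] that k by simp
  have fixed_zero: "fixed_points X T \<subseteq> zero_set X \<phi>"
    using \<phi>_le_G G_fixed by (fastforce simp: fixed_points_def zero_set_def)
  have fixed_unique: "x = y" if "x \<in> X" "y \<in> X" "T x = x" "T y = y" for x y
    using kannan[of x y] d_le_G[of x y] G_fixed that dist_eq_0_iff by simp
  define q where "q = k / (1 - k)"
  have q: "0 \<le> q" "q < 1" using k by (auto simp: q_def field_simps)
  have orbit: "\<exists>z\<in>X. T z = z \<and> cstar_converges d (\<lambda>n. (T ^^ n) x) z" if x: "x \<in> X" for x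
  proof -
    define s where "s n = (T ^^ n) x" for n
    have s_Suc: "s (Suc n) = T (s n)" for n by (simp add: s_def)
    have sX: "s n \<in> X" for n by (induction n) (simp_all add: s_def x TX)
    define C where "C = norm (G (s 1) (s 0))"
    have G_step: "norm (G (s (Suc n)) (s n)) \<le> C * q ^ n" for n
    proof (induction n)
      case (Suc n)
      let ?u = "norm (G (s (Suc (Suc n))) (s (Suc n)))" and ?v = "norm (G (s (Suc n)) (s n))"
      have "?u \<le> k * (?u + ?v)"
        using kannan[OF sX sX, of "Suc n" n] by (simp only: s_Suc)
      \<comment> \<open>The new term occurs on both sides; solving for it turns the factor \<open>k\<close> into \<open>k / (1 - k)\<close>.\<close>
      then have "?u \<le> q * ?v"
        using k by (simp add: q_def field_simps)
      also have "\<dots> \<le> q * (C * q ^ n)" using Suc.IH q by (intro mult_left_mono)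
      finally show ?case by (simp add: algebra_simps)
    qed (simp add: C_def)
    have "cstar_Cauchy d s"
      using geometric_cstar_Cauchy[OF _ q, of s C] G_step d_le_G sX dist_commute
      by (metis image_subset_iff order_trans)
    then obtain z where z: "z \<in> X" "cstar_converges d s z"
      using complete[of s] sX by blast
    have G_lim: "(\<lambda>n. norm (G (s (Suc n)) (s n))) \<longlonglongrightarrow> 0"
    proof (rule tendsto_sandwich[OF _ _ tendsto_const])
      show "(\<lambda>n. C * q ^ n) \<longlonglongrightarrow> 0"
        using q LIMSEQ_power_zero[of q] by (intro tendsto_mult_right_zero) simp
    qed (use G_step in auto)
    have "(\<lambda>n. norm (\<phi> (s (Suc n)))) \<longlonglongrightarrow> 0"
      by (rule tendsto_sandwich[OF _ _ tendsto_const G_lim]) (use \<phi>_le_G sX in auto)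
    then have \<phi>_lim: "(\<lambda>n. \<phi> (s (Suc n))) \<longlonglongrightarrow> 0" and "(\<lambda>n. norm (\<phi> (s n))) \<longlonglongrightarrow> 0"
      by (auto simp: tendsto_norm_zero_iff dest: LIMSEQ_imp_Suc)
    then have "(\<lambda>n. ereal (norm (\<phi> (s n)))) \<longlonglongrightarrow> ereal 0" by simp
    then have "liminf (\<lambda>n. ereal (norm (\<phi> (s n)))) = ereal 0"
      by (intro lim_imp_Liminf) auto
    moreover have "ereal (norm (\<phi> z)) \<le> liminf (\<lambda>n. ereal (norm (\<phi> (s n))))"
      using assms(5) z sX unfolding cstar_lsc_def by (metis image_subset_iff)
    ultimately have \<phi>z: "\<phi> z = 0" by simp
    have dist_lim: "(\<lambda>n. d (T z) (s (Suc n))) \<longlonglongrightarrow> d (T z) z"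
    proof -
      have "(\<lambda>n. norm (d (s (Suc n)) z)) \<longlonglongrightarrow> 0"
        using z(2) LIMSEQ_Suc unfolding cstar_converges_def by blast
      then have "(\<lambda>n. d (T z) (s (Suc n)) - d (T z) z) \<longlonglongrightarrow> 0"
        by (rule Lim_null_comparison[rotated]) (use norm_dist_diff sX z TX in auto)
      then show ?thesis by (simp add: LIM_zero_iff)
    qed
    have "(\<lambda>n. G (T z) (s (Suc n))) \<longlonglongrightarrow> G (T z) z"
      unfolding G_def \<phi>z
      by (intro F_class_tendsto[OF assms(3) dist_lim tendsto_const \<phi>_lim])
         (use dist_in_pos \<phi>_pos TX z sX \<phi>z in \<open>simp_all, metis\<close>)
    then have lhs: "(\<lambda>n. norm (G (T z) (s (Suc n)))) \<longlonglongrightarrow> norm (G (T z) z)"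
      by (rule tendsto_norm)
    have rhs: "(\<lambda>n. k * (norm (G (T z) z) + norm (G (s (Suc n)) (s n)))) \<longlonglongrightarrow> k * (norm (G (T z) z) + 0)"
      by (intro tendsto_intros G_lim)
    \<comment> \<open>\<open>z\<close> stands in the first place so that both sides involve the same value \<open>G (T z) z\<close>.\<close>
    have "norm (G (T z) z) \<le> k * (norm (G (T z) z) + 0)"
      by (rule LIMSEQ_le[OF lhs rhs]) (use kannan z sX in \<open>auto simp: s_Suc\<close>)
    then have "G (T z) z = 0" using contract_zero k by simp
    then have "T z = z" using d_le_G[of "T z" z] z TX dist_eq_0_iff by simp
    then show ?thesis using z unfolding s_def by blast
  qed
  obtain x0 where "x0 \<in> X" using nonempty by blast
  then obtain z where z: "z \<in> X" "T z = z" using orbit by blast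
  have "fixed_points X T \<inter> zero_set X \<phi> = {z}"
    using fixed_zero fixed_unique z by (auto simp: fixed_points_def)
  moreover have "\<forall>x\<in>X. cstar_converges d (\<lambda>n. (T ^^ n) x) z"
    using orbit fixed_unique z by metis
  ultimately show ?thesis
    using fixed_zero z(1) unfolding phi_Picard_operator_def by blast
qed

end
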